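(* Let $N\ge 2$, let $H_S$ be a traceless Hermitian $N\times N$ matrix, and let $(X_j)_{j\in J}$ be a nonempty family of traceless Hermitian $N\times N$ matrices. For each $j\in J$ let $\Lambda_j\subseteq\mathbb{R}$ be the set of admissible values of the coupling coefficient $\lambda(\alpha_j)$, and suppose that $0\in\Lambda_j$ and that $\Lambda_j$ contains elements of arbitrarily large absolute value. Let $\mathcal{G}\subseteq SU(N)$ be the set of all finite products $$\prod_{k=1}^{M} e^{-i(H_S+\lambda_k X_{j_k})\Delta t_k},\qquad M\ge 1,\ j_k\in J,\ \lambda_k\in\Lambda_{j_k},\ \Delta t_k\ge 0,$$ and let $\bar{\mathcal{G}}$ be the closure of $\mathcal{G}$ in $SU(N)$. If the real Lie algebra $su(N)$ is generated by $iH_S$ together with all the $iX_j$, $j\in J$, then $\bar{\mathcal{G}}=SU(N)$.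
   Context: $SU(N)$ is the Lie group of $N\times N$ unitary matrices of determinant $1$, with its usual topology, and $su(N)$ is its Lie algebra, the real Lie algebra of traceless anti-Hermitian $N\times N$ matrices. "Generated" means generated as a real Lie algebra: the smallest real Lie subalgebra of $su(N)$ containing the given elements is $su(N)$ itself. Setting (the "simplified model"): an $N$-level quantum system with free Hamiltonian $H_S$ is controlled through an auxiliary system (the accessor). Preparing the accessor in its $j$-th eigenstate makes the controlled system evolve under the effective Hamiltonian $H_S+H_j(S)$ (up to an additive scalar), where $H_j(S)=\lambda(\alpha_j)X_j$. The parameter $\alpha_j$ can be chosen freely in each control cycle, so that the real coefficient $\lambda(\alpha_j)$ can be made zero or can be given nonzero values, with $|\lambda(\alpha_j)|$ as large as desired. Each factor $e^{-i(H_S+\lambda_k X_{j_k})\Delta t_k}$ is the evolution during one control cycle of duration $\Delta t_k$, and $\mathcal{G}$ is the semigroup of all evolutions achievable in finitely many control cycles. The equality $\bar{\mathcal{G}}=SU(N)$ is the notion of complete controllability used here. *)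

theory Defs
  imports "HOL-Analysis.Analysis"
begin

type_synonym 'n cmat = "complex ^ 'n ^ 'n"

text \<open>Multiplication of vectors and matrices by \<^const>\<open>times\<close> is componentwise; the
  matrix product is \<^term>\<open>A ** B\<close>, with unit \<^term>\<open>mat 1\<close>.\<close>

definition cscale :: "complex \<Rightarrow> 'n::finite cmat \<Rightarrow> 'n cmat"  (infixr \<open>*\<^sub>C\<close> 75)
  where "c *\<^sub>C A = (\<chi> i j. c * A $ i $ j)"

definition dagger :: "'n::finite cmat \<Rightarrow> 'n cmat"
  where "dagger A = (\<chi> i j. cnj (A $ j $ i))"

definition hermitian :: "'n::finite cmat \<Rightarrow> bool"
  where "hermitian A \<longleftrightarrow> dagger A = A"

definition unitary :: "'n::finite cmat \<Rightarrow> bool"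
  where "unitary U \<longleftrightarrow> dagger U ** U = mat 1 \<and> U ** dagger U = mat 1"

definition SU :: "'n::finite cmat set"
  where "SU = {U. unitary U \<and> det U = 1}"

definition su :: "'n::finite cmat set"
  where "su = {A. dagger A = - A \<and> trace A = 0}"

definition mcomm :: "'n::finite cmat \<Rightarrow> 'n cmat \<Rightarrow> 'n cmat"
  where "mcomm A B = A ** B - B ** A"

text \<open>Here \<^const>\<open>subspace\<close> refers to real scalars.\<close>

definition lie_subalgebra_su :: "'n::finite cmat set \<Rightarrow> bool"
  where "lie_subalgebra_su L \<longleftrightarrow>
    L \<subseteq> su \<and> subspace L \<and> (\<forall>A\<in>L. \<forall>B\<in>L. mcomm A B \<in> L)"

text \<open>The \<open>hull\<close> is the intersection of all Lie subalgebras of \<^const>\<open>su\<close> that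
  contain \<open>S\<close>; it is the whole type if \<open>S\<close> is not a subset of \<^const>\<open>su\<close>, so the
  equation below also entails \<^term>\<open>S \<subseteq> su\<close>.\<close>

definition lie_generates_su :: "'n::finite cmat set \<Rightarrow> bool"
  where "lie_generates_su S \<longleftrightarrow> lie_subalgebra_su hull S = su"

text \<open>The class-based \<^const>\<open>exp\<close> is not available for matrices, hence the explicit power
  series; it converges by \<open>mexp_sums\<close> below.\<close>

definition mexp :: "'n::finite cmat \<Rightarrow> 'n cmat"
  where "mexp A = (\<Sum>k. (1 / fact k) *\<^sub>R (((**) A ^^ k) (mat 1)))"

lemma mexp_sums:
  fixes A :: "'n::finite cmat"
  shows "(\<lambda>k. (1 / fact k) *\<^sub>R (((**) A ^^ k) (mat 1))) sums mexp A"
proof -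
  have "linear ((**) A :: 'n cmat \<Rightarrow> 'n cmat)"
    by (rule linearI)
      (simp_all add: matrix_matrix_mult_def vec_eq_iff scaleR_sum_right
        distrib_left sum.distrib)
  then obtain K where K: "K > 0" "\<And>B :: 'n cmat. norm (A ** B) \<le> norm B * K"
    using bounded_linear.pos_bounded linear_conv_bounded_linear by blast
  have bd: "norm (((**) A ^^ k) (mat 1)) \<le> norm (mat 1 :: 'n cmat) * K ^ k" for k
  proof (induction k)
    case (Suc k)
    have "norm (((**) A ^^ Suc k) (mat 1)) \<le> norm (((**) A ^^ k) (mat 1)) * K"
      using K(2) by simp
    also have "\<dots> \<le> (norm (mat 1 :: 'n cmat) * K ^ k) * K"
      using Suc K(1) by (intro mult_right_mono) auto
    finally show ?case by (simp add: algebra_simps)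
  qed simp
  have "summable (\<lambda>k. norm (mat 1 :: 'n cmat) * (inverse (fact k) * K ^ k))"
    by (intro summable_mult summable_exp)
  then have "summable (\<lambda>k. (1 / fact k) *\<^sub>R (((**) A ^^ k) (mat 1)))"
    by (rule summable_comparison_test')
      (use bd in \<open>auto simp: field_simps intro!: divide_right_mono\<close>)
  then show ?thesis
    unfolding mexp_def by (rule summable_sums)
qed

definition cycle_evolution :: "'n::finite cmat \<Rightarrow> ('j \<Rightarrow> 'n cmat) \<Rightarrow> 'j \<times> real \<times> real \<Rightarrow> 'n cmat"
  where "cycle_evolution H X = (\<lambda>(j, l, t). mexp ((- \<i> * of_real t) *\<^sub>C (H + l *\<^sub>R X j)))"

definition reachable ::
  "'n::finite cmat \<Rightarrow> 'j set \<Rightarrow> ('j \<Rightarrow> 'n cmat) \<Rightarrow> ('j \<Rightarrow> real set) \<Rightarrow> 'n cmat set"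
  where "reachable H J X \<Lambda> =
    {foldr (**) (map (cycle_evolution H X) cs) (mat 1) | cs.
       cs \<noteq> [] \<and> (\<forall>(j, l, t)\<in>set cs. j \<in> J \<and> l \<in> \<Lambda> j \<and> 0 \<le> t)}"

end

theory Submission
  imports Defs
begin

text \<open>
  The closure \<open>K\<close> of the reachable set is a closed subsemigroup of a compact group, hence a group.
  By the Lie product formula and by differentiating conjugates, the set \<open>L\<close> of all \<open>A\<close> in \<open>su(N)\<close>
  with \<open>exp (t A) \<in> K\<close> for all real \<open>t\<close> is a Lie algebra. It contains \<open>i (H + \<lambda> X\<^sub>j)\<close> for every
  admissible \<open>\<lambda>\<close>, since \<open>K\<close> is a group and negative times are therefore available; taking
  \<open>\<lambda> = 0\<close> and one \<open>\<lambda> \<noteq> 0\<close> gives \<open>iH\<close> and all \<open>iX\<^sub>j\<close>, so \<open>L = su(N)\<close>.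

  That \<open>exp su(N) \<subseteq> K\<close> forces \<open>K = SU(N)\<close> is seen without diagonalization. Given \<open>U\<close> in \<open>SU(N)\<close>,
  let \<open>V\<close> maximize \<open>Re tr\<close> over \<open>U W\<close>, where \<open>W\<close> is the compact group of all \<open>c k\<close> with \<open>\<bar>c\<bar> = 1\<close>
  and \<open>k \<in> K\<close>. The first-order condition says that \<open>V\<close> is Hermitian, so \<open>P = (1 - V) / 2\<close> is a
  projection and \<open>V = exp (i \<pi> P) \<in> W\<close>. Hence \<open>U \<in> W\<close>, and the scalar is absorbed into \<open>K\<close>.
\<close>

section \<open>One-parameter subgroups in Banach algebras\<close>

text \<open>Telescoping: one factor \<open>x\<close> or \<open>y\<close> at a time is exchanged, and
  each exchange costs \<open>M ^ n * norm (x - y)\<close>. Writing the exponent as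
  \<open>Suc n\<close> avoids truncated subtraction on the right.\<close>

lemma norm_power_diff_le:
  fixes x y :: "'a::real_normed_algebra_1"
  assumes "norm x \<le> M" "norm y \<le> M"
  shows "norm (x ^ Suc n - y ^ Suc n) \<le> real (Suc n) * M ^ n * norm (x - y)"
proof (induction n)
  case 0
  show ?case by simp
next
  case (Suc n)
  have M: "0 \<le> M" using assms(1) norm_ge_zero order_trans by blast
  have "x ^ Suc (Suc n) - y ^ Suc (Suc n) = x * (x ^ Suc n - y ^ Suc n) + (x - y) * y ^ Suc n"
    by (simp add: algebra_simps)
  also have "norm \<dots> \<le> norm x * norm (x ^ Suc n - y ^ Suc n) + norm (x - y) * norm (y ^ Suc n)"
    by (meson norm_triangle_le add_mono norm_mult_ineq)
  also have "\<dots> \<le> M * (real (Suc n) * M ^ n * norm (x - y)) + norm (x - y) * M ^ Suc n"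
    using Suc assms M norm_power_ineq[of y "Suc n"] power_mono[OF assms(2) norm_ge_zero, of "Suc n"]
    by (intro add_mono mult_mono mult_left_mono) auto
  finally show ?case by (simp add: algebra_simps)
qed

lemma vector_derivative_quotient_tendsto:
  fixes f :: "real \<Rightarrow> 'a::real_normed_vector"
  assumes "(f has_vector_derivative D) (at 0)"
  shows "((\<lambda>s. (f s - f 0) /\<^sub>R s) \<longlongrightarrow> D) (at 0)"
proof -
  have "((\<lambda>s. norm (f s - f 0 - s *\<^sub>R D) / norm s) \<longlongrightarrow> 0) (at 0)"
    using assms by (simp add: has_vector_derivative_def has_derivative_at)
  also have "?this \<longleftrightarrow> ((\<lambda>s. norm ((f s - f 0) /\<^sub>R s - D)) \<longlongrightarrow> 0) (at 0)"
  proof (rule filterlim_cong[OF refl refl])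
    have "norm (f s - f 0 - s *\<^sub>R D) / norm s = norm ((f s - f 0) /\<^sub>R s - D)" if "s \<noteq> 0" for s
    proof -
      have "(f s - f 0) /\<^sub>R s - D = inverse s *\<^sub>R (f s - f 0 - s *\<^sub>R D)"
        using that by (simp add: scaleR_diff_right)
      then show ?thesis by (simp add: divide_inverse_commute abs_inverse)
    qed
    then show "\<forall>\<^sub>F s in at 0. norm (f s - f 0 - s *\<^sub>R D) / norm s = norm ((f s - f 0) /\<^sub>R s - D)"
      by (auto simp: eventually_at_filter)
  qed
  finally show ?thesis
    by (simp add: tendsto_norm_zero_iff LIM_zero_iff)
qed

text \<open>The two series are compared termwise. Their constant terms cancel, so the index can be
  shifted by one; the factor \<open>Suc n\<close> from the power estimate then cancels against
  \<open>fact (Suc n)\<close>, which leaves the series of \<open>exp M\<close>.\<close>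

lemma norm_exp_diff_le:
  fixes x y :: "'a::{real_normed_algebra_1,banach}"
  assumes "norm x \<le> M" "norm y \<le> M"
  shows "norm (exp x - exp y) \<le> exp M * norm (x - y)"
proof -
  have "(\<lambda>n. x ^ n /\<^sub>R fact n - y ^ n /\<^sub>R fact n) sums (exp x - exp y)"
    by (intro sums_diff exp_converges)
  then have "(\<lambda>n. x ^ Suc n /\<^sub>R fact (Suc n) - y ^ Suc n /\<^sub>R fact (Suc n)) sums (exp x - exp y)"
    by (subst sums_Suc_iff) simp
  moreover have "(\<lambda>n. M ^ n /\<^sub>R fact n * norm (x - y)) sums (exp M * norm (x - y))"
    by (intro sums_mult2 exp_converges)
  moreover have "norm (x ^ Suc n /\<^sub>R fact (Suc n) - y ^ Suc n /\<^sub>R fact (Suc n))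
      \<le> M ^ n /\<^sub>R fact n * norm (x - y)" for n
  proof -
    have "norm (x ^ Suc n /\<^sub>R fact (Suc n) - y ^ Suc n /\<^sub>R fact (Suc n))
        = norm (x ^ Suc n - y ^ Suc n) / fact (Suc n)"
      by (simp add: divide_inverse_commute flip: scaleR_diff_right)
    also have "\<dots> \<le> (real (Suc n) * M ^ n * norm (x - y)) / fact (Suc n)"
      by (intro divide_right_mono norm_power_diff_le assms) simp
    also have "\<dots> = M ^ n /\<^sub>R fact n * norm (x - y)"
      by (simp add: divide_simps)
    finally show ?thesis .
  qed
  ultimately show ?thesis
    by (rule norm_sums_le)
qed

lemma continuous_exp_algebra:
  fixes f :: "'b::topological_space \<Rightarrow> 'a::{real_normed_algebra_1,banach}"
  assumes "continuous_on S f"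
  shows "continuous_on S (\<lambda>x. exp (f x))"
proof -
  have "isCont exp a" for a :: 'a
    unfolding isCont_def
  proof (rule LIM_zero_cancel, rule Lim_null_comparison)
    have "\<forall>\<^sub>F x in at a. norm (x - a) < 1"
      unfolding eventually_at by (rule exI[of _ 1]) (simp add: dist_norm)
    \<comment> \<open>On the unit ball around \<open>a\<close> all norms are at most
      \<open>norm a + 1\<close>, so \<open>exp\<close> is Lipschitz there.\<close>
    then show "\<forall>\<^sub>F x in at a. norm (exp x - exp a) \<le> exp (norm a + 1) * norm (x - a)"
    proof eventually_elim
      case (elim x)
      then show ?case
        using norm_triangle_ineq[of a "x - a"] by (intro norm_exp_diff_le) auto
    qed
    have "((\<lambda>x. exp (norm a + 1) * norm (x - a)) \<longlongrightarrow> exp (norm a + 1) * norm (a - a)) (at a)"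
      by (intro tendsto_intros)
    then show "((\<lambda>x. exp (norm a + 1) * norm (x - a)) \<longlongrightarrow> 0) (at a)"
      by simp
  qed
  then show ?thesis
    using assms continuous_on_compose2[of UNIV exp S f] continuous_at_imp_continuous_on by blast
qed

lemma exp_scaleR_power:
  fixes A :: "'a::{real_normed_algebra_1,banach}"
  shows "exp (s *\<^sub>R A) ^ n = exp ((real n * s) *\<^sub>R A)"
proof (induction n)
  case (Suc n)
  have "exp ((s + real n * s) *\<^sub>R A) = exp (s *\<^sub>R A) * exp ((real n * s) *\<^sub>R A)"
    unfolding scaleR_add_left by (rule exp_add_commuting) simp
  then show ?case using Suc by (simp add: algebra_simps)
qed simp

lemma exp_scaleR_has_vector_derivative_0:
  fixes A :: "'a::{real_normed_algebra_1,banach}"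
  shows "((\<lambda>t. exp (t *\<^sub>R A)) has_vector_derivative A) (at 0)"
  using exp_scaleR_has_vector_derivative_right[of A 0 UNIV] by simp

text \<open>The curve \<open>f\<close> agrees with \<open>exp (s *\<^sub>R A)\<close> to first order
  at 0. Over a step of length t/(n+1) the error is o(1/n), and n+1 factors add up only to o(1). For
  a product of two one-parameter groups this is the Lie product formula.\<close>

lemma power_tendsto_exp:
  fixes f :: "real \<Rightarrow> 'a::{real_normed_algebra_1,banach}"
  assumes f0: "f 0 = 1" and f': "(f has_vector_derivative A) (at 0)"
  shows "(\<lambda>n. f (t / real (Suc n)) ^ Suc n) \<longlonglongrightarrow> exp (t *\<^sub>R A)"
proof -
  define h where "h n = t / real (Suc n)" for n
  define g where "g s = exp (s *\<^sub>R A)" for s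
  have g': "(g has_vector_derivative A) (at 0)"
    unfolding g_def by (rule exp_scaleR_has_vector_derivative_0)
  have "(\<lambda>n. t * inverse (real (Suc n))) \<longlonglongrightarrow> t * 0"
    by (intro tendsto_mult tendsto_const LIMSEQ_inverse_real_of_nat)
  then have h0: "h \<longlonglongrightarrow> 0"
    by (simp add: h_def[abs_def] divide_inverse)
  \<comment> \<open>The relative remainder. Division by 0 gives \<open>q 0 = 0\<close>, which is
    also its limit, so \<open>q\<close> is continuous at 0.\<close>
  define q where "q s = (f s - g s) /\<^sub>R s" for s
  have "((\<lambda>s. f s - g s) has_vector_derivative A - A) (at 0)"
    by (intro has_vector_derivative_diff f' g')
  from vector_derivative_quotient_tendsto[OF this] have "isCont q 0"
    by (simp add: isCont_def q_def[abs_def] f0 g_def)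
  from isCont_tendsto_compose[OF this h0] have qh: "(\<lambda>n. q (h n)) \<longlonglongrightarrow> 0"
    by (simp add: q_def)
  have fg: "norm (f s - g s) = \<bar>s\<bar> * norm (q s)" for s
    by (cases "s = 0") (simp_all add: q_def f0 g_def)
  \<comment> \<open>The added 1 absorbs the remainder: once \<open>norm (q (h n)) < 1\<close>, the
    norm of \<open>f (h n)\<close> exceeds that of \<open>g (h n)\<close> by at most \<bar>h
    n\<bar>, which costs one more factor of the form exp \<bar>h n\<bar>.\<close>
  define C where "C = norm A + 1"
  have C: "C > 0" by (simp add: C_def add_nonneg_pos)
  have gA: "norm (g s) \<le> exp (\<bar>s\<bar> * norm A)" for s
    using norm_exp[of "s *\<^sub>R A"] by (simp add: g_def)
  also have "exp (\<bar>s\<bar> * norm A) \<le> exp (C * \<bar>s\<bar>)" for s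
    by (simp add: C_def algebra_simps)
  finally have gC: "norm (g s) \<le> exp (C * \<bar>s\<bar>)" for s .
  have "\<forall>\<^sub>F n in sequentially. norm (q (h n)) < 1"
    using order_tendstoD(2)[OF tendsto_norm_zero[OF qh], of 1] by simp
  then have fC: "\<forall>\<^sub>F n in sequentially. norm (f (h n)) \<le> exp (C * \<bar>h n\<bar>)"
  proof eventually_elim
    case (elim n)
    have "norm (f (h n)) \<le> norm (g (h n)) + norm (f (h n) - g (h n))"
      using norm_triangle_ineq[of "g (h n)" "f (h n) - g (h n)"] by simp
    also have "\<dots> \<le> exp (\<bar>h n\<bar> * norm A) + \<bar>h n\<bar>"
      using elim mult_left_mono[of "norm (q (h n))" 1 "\<bar>h n\<bar>"] by (intro add_mono gA) (simp add: fg)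
    also have "\<dots> \<le> exp (\<bar>h n\<bar> * norm A) * (1 + \<bar>h n\<bar>)"
      using mult_right_mono[of 1 "exp (\<bar>h n\<bar> * norm A)" "\<bar>h n\<bar>"] by (simp add: algebra_simps)
    also have "\<dots> \<le> exp (\<bar>h n\<bar> * norm A) * exp \<bar>h n\<bar>"
      using exp_ge_add_one_self by (intro mult_left_mono) auto
    also have "\<dots> = exp (C * \<bar>h n\<bar>)"
      by (simp add: C_def algebra_simps flip: exp_add)
    finally show ?case .
  qed
  have "\<forall>\<^sub>F n in sequentially. norm (f (h n) ^ Suc n - g (h n) ^ Suc n) \<le>
      \<bar>t\<bar> * exp (C * \<bar>t\<bar>) * norm (q (h n))"
    using fC
  proof eventually_elim
    case (elim n)
    have "real n * (C * \<bar>h n\<bar>) \<le> C * \<bar>t\<bar>"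
      using C unfolding h_def by (auto simp: field_simps)
    then have e: "exp (C * \<bar>h n\<bar>) ^ n \<le> exp (C * \<bar>t\<bar>)"
      by (simp flip: exp_of_nat_mult)
    have t: "real (Suc n) * \<bar>h n\<bar> = \<bar>t\<bar>"
      by (simp add: h_def)
    have "norm (f (h n) ^ Suc n - g (h n) ^ Suc n)
        \<le> real (Suc n) * exp (C * \<bar>h n\<bar>) ^ n * norm (f (h n) - g (h n))"
      using elim gC by (intro norm_power_diff_le) auto
    also have "\<dots> \<le> real (Suc n) * exp (C * \<bar>t\<bar>) * (\<bar>h n\<bar> * norm (q (h n)))"
      unfolding fg by (intro mult_right_mono mult_left_mono e) auto
    also have "\<dots> = (real (Suc n) * \<bar>h n\<bar>) * exp (C * \<bar>t\<bar>) * norm (q (h n))"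
      by (simp only: mult_ac)
    finally show ?case
      unfolding t .
  qed
  moreover have "(\<lambda>n. \<bar>t\<bar> * exp (C * \<bar>t\<bar>) * norm (q (h n))) \<longlonglongrightarrow> 0"
    using tendsto_mult_right_zero[OF tendsto_norm_zero[OF qh]] by blast
  ultimately have "(\<lambda>n. f (h n) ^ Suc n - g (h n) ^ Suc n) \<longlonglongrightarrow> 0"
    by (rule Lim_null_comparison)
  moreover have "g (h n) ^ Suc n = exp (t *\<^sub>R A)" for n
    by (simp add: g_def h_def exp_scaleR_power del: power_Suc of_nat_Suc)
  ultimately show ?thesis
    by (simp add: h_def LIM_zero_cancel del: power_Suc)
qed

text \<open>By compactness some powers of \<open>x\<close> come arbitrarily close to each other. If
  x^m is close to x^n with m > n, multiplying by y^(n+1) shows that x^(m-n-1) is close to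
  \<open>y\<close>. The powers of \<open>y\<close> stay in the bounded set \<open>G\<close>, so this
  multiplication enlarges distances by at most a fixed factor.\<close>

lemma compact_subsemigroup_inverse:
  fixes K G :: "'a::real_normed_algebra_1 set"
  assumes G: "bounded G" "\<And>x y. x \<in> G \<Longrightarrow> y \<in> G \<Longrightarrow> x * y \<in> G"
    and K: "compact K" "1 \<in> K" "\<And>x y. x \<in> K \<Longrightarrow> y \<in> K \<Longrightarrow> x * y \<in> K"
    and "x \<in> K" "y \<in> G" "y * x = 1"
  shows "y \<in> K"
proof -
  obtain B where B: "B > 0" "\<And>z. z \<in> G \<Longrightarrow> norm z \<le> B"
    using G(1) bounded_pos by blast
  have yG: "y ^ Suc n \<in> G" for n
    by (induction n) (use G(2) \<open>y \<in> G\<close> in auto)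
  have xK: "x ^ n \<in> K" for n
    by (induction n) (use K \<open>x \<in> K\<close> in auto)
  have yx: "y ^ n * x ^ n = 1" for n
  proof (induction n)
    case (Suc n)
    have "y ^ Suc n * x ^ Suc n = y ^ n * (y * x) * x ^ n"
      by (simp add: mult.assoc power_Suc2[of y] del: power_Suc) simp
    then show ?case using Suc assms by simp
  qed simp
  obtain l r where r: "strict_mono r" "((\<lambda>n. x ^ n) \<circ> r) \<longlonglongrightarrow> l"
    using K(1) xK unfolding compact_def by metis
  have "\<exists>z\<in>K. dist z y < e" if e: "e > 0" for e
  proof -
    have "Cauchy (\<lambda>n. x ^ r n)"
      using r(2) LIMSEQ_imp_Cauchy by (auto simp: comp_def)
    from CauchyD[OF this, of "e / B"] obtain M where M: "\<And>m n. m \<ge> M \<Longrightarrow> n \<ge> M \<Longrightarrow> norm (x ^ r m - x ^ r n) < e / B"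
      using e B(1) by auto
    define n where "n = r M"
    \<comment> \<open>The subtraction is not truncated, since \<open>r\<close> is strictly
      increasing. The 1 accounts for the one factor \<open>y\<close> that must survive on the other
      side.\<close>
    define d where "d = r (Suc M) - r M - 1"
    have d: "r (Suc M) = n + Suc d"
      using strict_monoD[OF r(1), of M "Suc M"] by (simp add: d_def n_def)
    have "x ^ r (Suc M) = x ^ Suc n * x ^ d"
      by (simp only: d power_add[symmetric] add_Suc add_Suc_right)
    then have "y ^ Suc n * x ^ r (Suc M) = y ^ Suc n * x ^ Suc n * x ^ d"
      by (simp only: mult.assoc)
    then have 1: "y ^ Suc n * x ^ r (Suc M) = x ^ d" by (simp only: yx mult_1)
    have 2: "y ^ Suc n * x ^ n = y"
      using yx[of n] by (simp add: mult.assoc)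
    have "norm (x ^ d - y) = norm (y ^ Suc n * (x ^ r (Suc M) - x ^ r M))"
      by (simp only: 1 2 right_diff_distrib n_def[symmetric])
    also have "\<dots> \<le> B * norm (x ^ r (Suc M) - x ^ r M)"
      using B yG[of n] by (meson norm_mult_ineq order_trans mult_right_mono norm_ge_zero)
    also have "\<dots> < B * (e / B)"
      using M[of "Suc M" M] B(1) by (intro mult_strict_left_mono) auto
    finally have "dist (x ^ d) y < e" using B(1) by (simp add: dist_norm)
    then show ?thesis using xK by blast
  qed
  then have "y \<in> closure K" by (simp add: closure_approachable)
  then show ?thesis using K(1) compact_imp_closed closure_closed by blast
qed

text \<open>For a closed subgroup of a matrix group this is its Lie algebra. Letting
  \<open>t\<close> range over negative reals too makes it a linear subspace even when
  \<open>K\<close> is only assumed to be a closed monoid.\<close>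

definition one_param :: "'a::{real_normed_algebra_1,banach} set \<Rightarrow> 'a set"
  where "one_param K = {A. \<forall>t. exp (t *\<^sub>R A) \<in> K}"

lemma power_in_submonoid:
  fixes x :: "'a::monoid_mult"
  assumes "1 \<in> K" "\<And>x y. x \<in> K \<Longrightarrow> y \<in> K \<Longrightarrow> x * y \<in> K" "x \<in> K"
  shows "x ^ n \<in> K"
  by (induction n) (use assms in auto)

context
  fixes K :: "'a::{real_normed_algebra_1,banach} set"
  assumes K: "closed K" "1 \<in> K" "\<And>x y. x \<in> K \<Longrightarrow> y \<in> K \<Longrightarrow> x * y \<in> K"
begin

text \<open>The powers of \<open>f (t / Suc n)\<close> lie in the monoid and converge to
  \<open>exp (t *\<^sub>R A)\<close>, which stays in \<open>K\<close> by closedness. Thus every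
  tangent vector at 1 of a curve in \<open>K\<close> generates a one-parameter group in
  \<open>K\<close>.\<close>

lemma one_param_derivative:
  assumes "f 0 = 1" "(f has_vector_derivative A) (at 0)" "\<And>t. f t \<in> K"
  shows "A \<in> one_param K"
proof -
  have "exp (t *\<^sub>R A) \<in> K" for t
    by (rule closed_sequentially[OF K(1) _ power_tendsto_exp[OF assms(1,2)]])
      (rule power_in_submonoid[OF K(2,3) assms(3)])
  then show ?thesis by (simp add: one_param_def)
qed

lemma one_param_add:
  assumes "A \<in> one_param K" "B \<in> one_param K"
  shows "A + B \<in> one_param K"
proof (rule one_param_derivative)
  show "((\<lambda>t. exp (t *\<^sub>R A) * exp (t *\<^sub>R B)) has_vector_derivative A + B) (at 0)"
    using has_vector_derivative_mult[OF exp_scaleR_has_vector_derivative_0[of A] exp_scaleR_has_vector_derivative_0[of B]]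
    by (simp add: add.commute)
qed (use assms K(3) in \<open>auto simp: one_param_def\<close>)

lemma one_param_scaleR: "A \<in> one_param K \<Longrightarrow> c *\<^sub>R A \<in> one_param K"
  by (simp add: one_param_def)

lemma subspace_one_param: "subspace (one_param K)"
  by (rule subspaceI) (auto intro: one_param_add one_param_scaleR, simp add: one_param_def K(2))

lemma closed_one_param: "closed (one_param K)"
proof -
  have "one_param K = (\<Inter>t. (\<lambda>A. exp (t *\<^sub>R A)) -` K)"
    by (auto simp: one_param_def)
  moreover have "continuous_on UNIV (\<lambda>A :: 'a. exp (t *\<^sub>R A))" for t
    by (intro continuous_exp_algebra continuous_intros)
  ultimately show ?thesis
    using K(1) by (auto intro!: closed_INT simp: closed_vimage)
qed

text \<open>With \<open>s\<close> fixed, the conjugate is the derivative at t = 0 of a curve in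
  \<open>K\<close>, namely the conjugated one-parameter group of \<open>B\<close>.\<close>

lemma one_param_conj:
  assumes "A \<in> one_param K" "B \<in> one_param K"
  shows "exp (s *\<^sub>R A) * B * exp (- (s *\<^sub>R A)) \<in> one_param K"
proof (rule one_param_derivative)
  have "((\<lambda>t. exp (s *\<^sub>R A) * exp (t *\<^sub>R B)) has_vector_derivative exp (s *\<^sub>R A) * B) (at 0)"
    using has_vector_derivative_mult[OF has_vector_derivative_const exp_scaleR_has_vector_derivative_0[of B], of "exp (s *\<^sub>R A)"]
    by simp
  from has_vector_derivative_mult[OF this has_vector_derivative_const]
  show "((\<lambda>t. exp (s *\<^sub>R A) * exp (t *\<^sub>R B) * exp (- (s *\<^sub>R A)))
      has_vector_derivative exp (s *\<^sub>R A) * B * exp (- (s *\<^sub>R A))) (at 0)"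
    by simp
  show "exp (s *\<^sub>R A) * exp (t *\<^sub>R B) * exp (- (s *\<^sub>R A)) \<in> K" for t
    using assms K(3) unfolding one_param_def by (metis (mono_tags, lifting) mem_Collect_eq scaleR_minus_left)
qed (simp add: exp_minus_inverse)

text \<open>The commutator is the derivative at s = 0 of the conjugates of \<open>B\<close> by
  \<open>exp (s *\<^sub>R A)\<close>. Their difference quotients lie in \<open>one_param K\<close>,
  a closed subspace, and so does the limit.\<close>

lemma one_param_commutator:
  assumes "A \<in> one_param K" "B \<in> one_param K"
  shows "A * B - B * A \<in> one_param K"
proof -
  define C where "C s = exp (s *\<^sub>R A) * B * exp (s *\<^sub>R (- A))" for s
  have C: "C s \<in> one_param K" for s
    using one_param_conj[OF assms, of s] by (simp add: C_def)
  have "(C has_vector_derivative A * B - B * A) (at 0)"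
  proof -
    have "((\<lambda>t. exp (t *\<^sub>R A) * B) has_vector_derivative A * B) (at 0)"
      using has_vector_derivative_mult[OF exp_scaleR_has_vector_derivative_0[of A] has_vector_derivative_const, of B]
      by simp
    from has_vector_derivative_mult[OF this exp_scaleR_has_vector_derivative_0[of "- A"]]
    show ?thesis by (simp add: C_def[abs_def])
  qed
  then have "((\<lambda>s. (C s - C 0) /\<^sub>R s) \<longlongrightarrow> A * B - B * A) (at 0)"
    by (rule vector_derivative_quotient_tendsto)
  moreover have "(C s - C 0) /\<^sub>R s \<in> one_param K" for s
    by (intro subspace_mul subspace_diff subspace_one_param C)
  ultimately show ?thesis
    by (intro Lim_in_closed_set[OF closed_one_param, of _ "at 0"]) auto
qed

end

section \<open>Complex matrices as a Banach algebra\<close>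

text \<open>A copy of the matrix type, since the class multiplication and norm of matrices are
  componentwise and Euclidean; with the product and the operator norm, \<^const>\<open>exp\<close> applies.\<close>

typedef 'n sqmat = "UNIV :: 'n::finite cmat set"
  morphisms cmat_of sqmat_of ..

setup_lifting type_definition_sqmat

lemma scaleR_matrix_mult:
  fixes A B :: "'n::finite cmat"
  shows "(r *\<^sub>R A) ** B = r *\<^sub>R (A ** B)" "A ** (r *\<^sub>R B) = r *\<^sub>R (A ** B)"
  by (simp_all add: matrix_matrix_mult_def vec_eq_iff scaleR_sum_right)

lemma matrix_mult_add_rdistrib:
  fixes A B C :: "'n::finite cmat"
  shows "(A + B) ** C = A ** C + B ** C"
  by (simp add: matrix_matrix_mult_def vec_eq_iff distrib_right sum.distrib)

lemma matrix_mult_diff_distrib: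
  fixes A B C :: "'n::finite cmat"
  shows "(A - B) ** C = A ** C - B ** C" "A ** (B - C) = A ** B - A ** C"
  by (simp_all add: matrix_matrix_mult_def vec_eq_iff left_diff_distrib right_diff_distrib sum_subtractf)

instantiation sqmat :: (finite) real_normed_algebra_1
begin

lift_definition zero_sqmat :: "'a sqmat" is 0 .
lift_definition one_sqmat :: "'a sqmat" is "mat 1" .
lift_definition plus_sqmat :: "'a sqmat \<Rightarrow> 'a sqmat \<Rightarrow> 'a sqmat" is "(+)" .
lift_definition minus_sqmat :: "'a sqmat \<Rightarrow> 'a sqmat \<Rightarrow> 'a sqmat" is "(-)" .
lift_definition uminus_sqmat :: "'a sqmat \<Rightarrow> 'a sqmat" is uminus .
lift_definition times_sqmat :: "'a sqmat \<Rightarrow> 'a sqmat \<Rightarrow> 'a sqmat" is "(**)" .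
lift_definition scaleR_sqmat :: "real \<Rightarrow> 'a sqmat \<Rightarrow> 'a sqmat" is scaleR .
lift_definition norm_sqmat :: "'a sqmat \<Rightarrow> real" is "\<lambda>A. onorm ((*v) A)" .

definition dist_sqmat :: "'a sqmat \<Rightarrow> 'a sqmat \<Rightarrow> real"
  where "dist_sqmat A B = norm (A - B)"

definition sgn_sqmat :: "'a sqmat \<Rightarrow> 'a sqmat"
  where "sgn_sqmat A = scaleR (inverse (norm A)) A"

definition uniformity_sqmat :: "('a sqmat \<times> 'a sqmat) filter"
  where "uniformity_sqmat = (INF e\<in>{0 <..}. principal {(x, y). dist x y < e})"

definition open_sqmat :: "'a sqmat set \<Rightarrow> bool"
  where "open_sqmat S = (\<forall>x\<in>S. \<forall>\<^sub>F (x', y) in uniformity. x' = x \<longrightarrow> y \<in> S)"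

instance
proof
  fix A B C :: "'a sqmat" and a b :: real
  show "A + B + C = A + (B + C)" "A + B = B + A" "0 + A = A" "- A + A = 0" "A - B = A + - B"
    "a *\<^sub>R (A + B) = a *\<^sub>R A + a *\<^sub>R B" "(a + b) *\<^sub>R A = a *\<^sub>R A + b *\<^sub>R A"
    "a *\<^sub>R b *\<^sub>R A = (a * b) *\<^sub>R A" "1 *\<^sub>R A = A"
    by (transfer; simp add: algebra_simps)+
  show "A * B * C = A * (B * C)" "1 * A = A" "A * 1 = A"
    "(A + B) * C = A * C + B * C" "A * (B + C) = A * B + A * C"
    "a *\<^sub>R A * B = a *\<^sub>R (A * B)" "A * a *\<^sub>R B = a *\<^sub>R (A * B)"
    by (transfer; simp add: matrix_mul_assoc scaleR_matrix_mult matrix_add_ldistrib matrix_mult_add_rdistrib)+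
  show "(0 :: 'a sqmat) \<noteq> 1"
    by transfer (simp add: vec_eq_iff mat_def)
  show "norm A = 0 \<longleftrightarrow> A = 0"
    by transfer (simp add: onorm_eq_0 matrix_eq)
  show "norm (A + B) \<le> norm A + norm B"
    by transfer (simp add: matrix_vector_mult_add_rdistrib[abs_def] onorm_triangle)
  show "norm (a *\<^sub>R A) = \<bar>a\<bar> * norm A"
  proof transfer
    fix a and A :: "'a cmat"
    have "(*v) (a *\<^sub>R A) = (\<lambda>x. a *\<^sub>R (A *v x))"
      by (simp add: fun_eq_iff matrix_vector_mult_def vec_eq_iff scaleR_sum_right)
    then show "onorm ((*v) (a *\<^sub>R A)) = \<bar>a\<bar> * onorm ((*v) A)"
      by (simp add: onorm_scaleR)
  qed
  show "norm (A * B) \<le> norm A * norm B"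
    by transfer (metis matrix_vector_mult_matrix_matrix_mult_compose matrix_vector_mul_bounded_linear onorm_compose)
  show "norm (1 :: 'a sqmat) = 1"
  proof transfer
    have "(*v) (mat 1) = (\<lambda>x :: complex ^ 'a. x)"
      by (simp add: fun_eq_iff)
    then show "onorm ((*v) (mat 1 :: 'a cmat)) = 1"
      by (simp add: onorm_id)
  qed
qed (simp_all add: dist_sqmat_def sgn_sqmat_def uniformity_sqmat_def open_sqmat_def)

end

lemma bounded_linear_sqmat_of: "bounded_linear (sqmat_of :: 'n::finite cmat \<Rightarrow> 'n sqmat)"
  unfolding linear_conv_bounded_linear[symmetric]
  by (rule linearI) (simp_all add: plus_sqmat.abs_eq scaleR_sqmat.abs_eq)

text \<open>Each entry is a coordinate of the image of a unit vector, hence bounded by the operator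
  norm. The estimate makes \<open>cmat_of\<close> bounded, so limits and derivatives move between
  the two matrix types.\<close>

lemma norm_cmat_of_le:
  fixes A :: "'n::finite sqmat"
  shows "norm (cmat_of A) \<le> norm A * (real CARD('n) * real CARD('n))"
proof -
  have *: "norm (cmat_of A $ i $ j) \<le> norm A" for i j
  proof -
    have "cmat_of A $ i $ j = (cmat_of A *v axis j 1) $ i"
      by (simp add: matrix_vector_mult_def axis_def if_distrib cong: if_cong)
    also have "norm \<dots> \<le> norm (cmat_of A *v axis j 1)"
      by (rule Finite_Cartesian_Product.norm_nth_le)
    also have "\<dots> \<le> onorm ((*v) (cmat_of A)) * norm (axis j (1::complex))"
      by (rule onorm) simp
    finally show ?thesis by (simp add: norm_sqmat.rep_eq norm_axis_1)
  qed
  have "norm (cmat_of A) \<le> (\<Sum>i\<in>UNIV. norm (cmat_of A $ i))"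
    by (simp add: norm_vec_def L2_set_le_sum)
  also have "\<dots> \<le> (\<Sum>i\<in>UNIV. \<Sum>j\<in>UNIV. norm (cmat_of A $ i $ j))"
    by (intro sum_mono) (simp add: norm_vec_def L2_set_le_sum)
  also have "\<dots> \<le> (\<Sum>i\<in>(UNIV::'n set). \<Sum>j\<in>(UNIV::'n set). norm A)"
    by (intro sum_mono *)
  finally show ?thesis by (simp add: algebra_simps)
qed

lemma bounded_linear_cmat_of: "bounded_linear (cmat_of :: 'n::finite sqmat \<Rightarrow> 'n cmat)"
  by (rule bounded_linear_intro[OF _ _ norm_cmat_of_le])
    (simp_all add: plus_sqmat.rep_eq scaleR_sqmat.rep_eq)

instance sqmat :: (finite) banach
proof
  fix F :: "nat \<Rightarrow> 'a sqmat"
  assume "Cauchy F"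
  then have "Cauchy (\<lambda>n. cmat_of (F n))"
    by (rule bounded_linear.Cauchy[OF bounded_linear_cmat_of])
  then obtain L where "(\<lambda>n. cmat_of (F n)) \<longlonglongrightarrow> L"
    using Cauchy_convergent convergent_def by blast
  from bounded_linear.tendsto[OF bounded_linear_sqmat_of this]
  show "convergent F"
    by (auto simp: convergent_def cmat_of_inverse)
qed

section \<open>The exponential series of matrices\<close>

lemma mexp_eq_exp: "mexp A = cmat_of (exp (sqmat_of A))"
proof -
  have *: "cmat_of (sqmat_of A ^ k) = ((**) A ^^ k) (mat 1)" for k
    by (induction k) (simp_all add: one_sqmat.rep_eq times_sqmat.rep_eq sqmat_of_inverse)
  have "(\<lambda>k. cmat_of (sqmat_of A ^ k /\<^sub>R fact k)) sums cmat_of (exp (sqmat_of A))"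
    by (rule bounded_linear.sums[OF bounded_linear_cmat_of exp_converges])
  then show ?thesis
    using mexp_sums[of A] by (simp add: scaleR_sqmat.rep_eq * divide_inverse sums_iff)
qed

lemma mexp_add: "A ** B = B ** A \<Longrightarrow> mexp (A + B) = mexp A ** mexp B"
  by (simp add: mexp_eq_exp exp_add_commuting eq_onp_same_args
      plus_sqmat.abs_eq[symmetric] times_sqmat.abs_eq flip: times_sqmat.rep_eq)

lemma mexp_0 [simp]: "mexp 0 = mat 1"
  by (simp add: mexp_eq_exp one_sqmat.rep_eq flip: zero_sqmat_def)

lemma mexp_has_vector_derivative:
  "((\<lambda>t. mexp (t *\<^sub>R A)) has_vector_derivative mexp (t *\<^sub>R A) ** A) (at t)"
proof -
  have "((\<lambda>t. cmat_of (exp (t *\<^sub>R sqmat_of A))) has_vector_derivative cmat_of (exp (t *\<^sub>R sqmat_of A) * sqmat_of A)) (at t)"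
    by (rule bounded_linear.has_vector_derivative[OF bounded_linear_cmat_of
          exp_scaleR_has_vector_derivative_right])
  then show ?thesis
    by (simp add: mexp_eq_exp scaleR_sqmat.abs_eq times_sqmat.rep_eq sqmat_of_inverse)
qed

text \<open>For k \<ge> 1 the k-th power of zP is z^k P, so the series is that of the scalar
  exponential times P except in the zeroth term.\<close>

lemma mexp_projection:
  assumes "P ** P = P"
  shows "mexp (z *\<^sub>C P) = mat 1 + (exp z - 1) *\<^sub>C P"
proof -
  have "bounded_linear (\<lambda>c. c *\<^sub>C P)"
    unfolding linear_conv_bounded_linear[symmetric]
    by (rule linearI) (simp_all add: cscale_def vec_eq_iff algebra_simps)
  from bounded_linear.sums[OF this exp_converges[of z]]
  have "(\<lambda>k. (z ^ k /\<^sub>R fact k) *\<^sub>C P) sums (exp z *\<^sub>C P)" .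
  \<comment> \<open>The zeroth power is \<open>mat 1\<close> and not \<open>P\<close>; this one-term
    series corrects it.\<close>
  moreover have "(\<lambda>k. if k = 0 then mat 1 - P else 0) sums (mat 1 - P)"
    using sums_If_finite_set[of "{0}" "\<lambda>_. mat 1 - P"] by simp
  ultimately have "(\<lambda>k. (z ^ k /\<^sub>R fact k) *\<^sub>C P + (if k = 0 then mat 1 - P else 0))
      sums (exp z *\<^sub>C P + (mat 1 - P))"
    by (rule sums_add)
  also have "(\<lambda>k. (z ^ k /\<^sub>R fact k) *\<^sub>C P + (if k = 0 then mat 1 - P else 0)) =
      (\<lambda>k. (1 / fact k) *\<^sub>R ((**) (z *\<^sub>C P) ^^ k) (mat 1))"
  proof
    fix k
    have "((**) (z *\<^sub>C P) ^^ Suc k) (mat 1) = z ^ Suc k *\<^sub>C P" for k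
    proof (induction k)
      case (Suc k)
      have "(z *\<^sub>C P) ** (c *\<^sub>C P) = (z * c) *\<^sub>C (P ** P)" for c
        by (simp add: cscale_def matrix_matrix_mult_def vec_eq_iff sum_distrib_left algebra_simps)
      then show ?case using Suc assms by simp
    qed simp
    then show "(z ^ k /\<^sub>R fact k) *\<^sub>C P + (if k = 0 then mat 1 - P else 0) =
      (1 / fact k) *\<^sub>R ((**) (z *\<^sub>C P) ^^ k) (mat 1)"
      by (cases k) (simp_all add: cscale_def vec_eq_iff divide_inverse del: funpow.simps)
  qed
  finally have "exp z *\<^sub>C P + (mat 1 - P) = mexp (z *\<^sub>C P)"
    using mexp_sums sums_unique2 by blast
  then show ?thesis
    by (simp add: cscale_def vec_eq_iff algebra_simps)
qed

section \<open>The matrix exponential on \<^const>\<open>su\<close>\<close>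

lemma dagger_nth [simp]: "dagger A $ i $ j = cnj (A $ j $ i)"
  by (simp add: dagger_def)

lemma cscale_nth [simp]: "(c *\<^sub>C A) $ i $ j = c * A $ i $ j"
  by (simp add: cscale_def)

lemma dagger_simps [simp]:
  "dagger 0 = 0"
  "dagger (A + B) = dagger A + dagger B"
  "dagger (A - B) = dagger A - dagger B"
  "dagger (- A) = - dagger A"
  "dagger (r *\<^sub>R A) = r *\<^sub>R dagger A"
  "dagger (c *\<^sub>C A) = cnj c *\<^sub>C dagger A"
  "dagger (dagger A) = A"
  "dagger (mat 1) = mat 1"
  by (auto simp: vec_eq_iff mat_def)

lemma dagger_mult: "dagger (A ** B) = dagger B ** dagger A"
  by (simp add: vec_eq_iff matrix_matrix_mult_def mult.commute)

lemma bounded_linear_dagger: "bounded_linear (dagger :: 'n::finite cmat \<Rightarrow> 'n cmat)"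
  unfolding linear_conv_bounded_linear[symmetric] by (rule linearI) simp_all

lemma dagger_mexp: "dagger (mexp A) = mexp (dagger A)"
proof -
  have comm: "A ** ((**) A ^^ k) (mat 1) = ((**) A ^^ k) (mat 1) ** A" for k
    by (induction k) (simp_all add: matrix_mul_assoc)
  have "dagger (((**) A ^^ k) (mat 1)) = ((**) (dagger A) ^^ k) (mat 1)" for k
    by (induction k) (simp_all add: comm dagger_mult)
  then have "(\<lambda>k. (1 / fact k) *\<^sub>R ((**) (dagger A) ^^ k) (mat 1)) sums dagger (mexp A)"
    using bounded_linear.sums[OF bounded_linear_dagger mexp_sums[of A]] by simp
  then show ?thesis
    using mexp_sums sums_unique2 by blast
qed

lemma cscale_mult:
  "(c *\<^sub>C A) ** B = c *\<^sub>C (A ** B)" "A ** (c *\<^sub>C B) = c *\<^sub>C (A ** B)"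
  by (simp_all add: vec_eq_iff matrix_matrix_mult_def sum_distrib_left mult_ac)

lemma cscale_simps:
  "c *\<^sub>C (d *\<^sub>C A) = (c * d) *\<^sub>C A" "1 *\<^sub>C A = A"
  by (simp_all add: vec_eq_iff)

lemma trace_linear [simp]:
  fixes A B :: "'n::finite cmat"
  shows "trace (c *\<^sub>C A) = c * trace A" "trace (r *\<^sub>R A) = r *\<^sub>R trace A"
  by (simp_all add: trace_def sum_distrib_left scaleR_sum_right)

lemma bounded_linear_trace: "bounded_linear (trace :: 'n::finite cmat \<Rightarrow> complex)"
  unfolding linear_conv_bounded_linear[symmetric] by (rule linearI) (simp_all add: trace_add)

lemma bounded_bilinear_cmat_mult: "bounded_bilinear ((**) :: 'n::finite cmat \<Rightarrow> 'n cmat \<Rightarrow> 'n cmat)"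
  unfolding bilinear_conv_bounded_bilinear[symmetric] bilinear_def
  by (auto intro!: linearI simp: scaleR_matrix_mult matrix_add_ldistrib matrix_mult_add_rdistrib)

lemma bounded_bilinear_cscale: "bounded_bilinear (cscale :: complex \<Rightarrow> 'n::finite cmat \<Rightarrow> 'n cmat)"
  unfolding bilinear_conv_bounded_bilinear[symmetric] bilinear_def
  by (auto intro!: linearI simp: vec_eq_iff algebra_simps)

lemma det_cscale:
  fixes A :: "'n::finite cmat"
  shows "det (c *\<^sub>C A) = c ^ CARD('n) * det A"
  using det_rows_mul[of "\<lambda>_. c" "\<lambda>i. A $ i"]
  by (simp add: cscale_def vector_scalar_mult_def)

text \<open>The norm of \<open>cmat\<close> is the Euclidean norm of the entries, that is, the
  Frobenius norm.\<close>

lemma trace_dagger_mult: "trace (dagger A ** A) = of_real ((norm A)\<^sup>2)"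
proof -
  have "(norm A)\<^sup>2 = (\<Sum>i\<in>UNIV. \<Sum>j\<in>UNIV. (norm (A $ i $ j))\<^sup>2)"
    by (simp add: norm_vec_def L2_set_def sum_nonneg)
  also have "of_real \<dots> = (\<Sum>i\<in>UNIV. \<Sum>j\<in>UNIV. cnj (A $ i $ j) * A $ i $ j)"
    by (simp add: complex_norm_square mult.commute del: of_real_power)
  also have "\<dots> = trace (dagger A ** A)"
    by (subst sum.swap) (simp add: trace_def matrix_matrix_mult_def)
  finally show ?thesis ..
qed

section \<open>Jacobi's formula and the determinant of the exponential\<close>

lemma has_vector_derivative_nth:
  "(f has_vector_derivative D) F \<Longrightarrow> ((\<lambda>t. f t $ i) has_vector_derivative D $ i) F"
  by (rule bounded_linear.has_vector_derivative[OF bounded_linear_vec_nth])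

text \<open>In the Leibniz expansion a permutation other than \<open>id\<close> moves at least two
  points. Differentiating removes one factor, so an off-diagonal entry of the identity matrix
  remains and the term vanishes; the term of \<open>id\<close> gives the trace.\<close>

lemma det_has_vector_derivative_at_mat_1:
  fixes M :: "real \<Rightarrow> 'n::finite cmat"
  assumes "(M has_vector_derivative D) (at 0)" "M 0 = mat 1"
  shows "((\<lambda>t. det (M t)) has_vector_derivative trace D) (at 0)"
proof -
  have entry: "((\<lambda>t. M t $ i $ j) has_derivative (\<lambda>y. y *\<^sub>R D $ i $ j)) (at 0)" for i j
    using has_vector_derivative_nth[OF has_vector_derivative_nth[OF assms(1)]]
    by (simp add: has_vector_derivative_def)
  let ?S = "{p. p permutes (UNIV :: 'n set)}"
  define T where "T y p = (\<Sum>i\<in>UNIV. y *\<^sub>R D $ i $ p i * (\<Prod>j\<in>UNIV - {i}. mat 1 $ j $ p j))" for y p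
  have der: "((\<lambda>t. det (M t)) has_derivative (\<lambda>y. \<Sum>p\<in>?S. of_int (sign p) * T y p)) (at 0)"
    unfolding det_def T_def assms(2)[symmetric]
    by (intro has_derivative_sum has_derivative_mult_right has_derivative_prod entry)
  have "T y p = 0" if p: "p permutes UNIV" "p \<noteq> id" for y p
  proof -
    obtain a where a: "p a \<noteq> a" using p(2) by (auto simp: fun_eq_iff)
    \<comment> \<open>By injectivity \<open>p a\<close> is a second moved point, so one of
      \<open>a\<close> and \<open>p a\<close> differs from any given \<open>i\<close>.\<close>
    have ne: "p (p a) \<noteq> p a"
      using a permutes_inj[OF p(1)] by (meson injD)
    have "(\<Prod>j\<in>UNIV - {i}. (mat 1 :: 'n cmat) $ j $ p j) = 0" for i
    proof -
      obtain j where j: "j \<noteq> i" "j \<noteq> p j"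
        using a ne by metis
      then have "(mat 1 :: 'n cmat) $ j $ p j = 0"
        by (simp add: mat_def)
      with j(1) show ?thesis by (intro prod_zero) auto
    qed
    then show ?thesis by (simp only: T_def mult_zero_right sum.neutral_const)
  qed
  then have "(\<Sum>p\<in>?S. of_int (sign p) * T y p) = (\<Sum>p\<in>{id}. of_int (sign p) * T y p)" for y
    by (intro sum.mono_neutral_right) (auto simp: permutes_id finite_permutations)
  also have "(\<Sum>p\<in>{id}. of_int (sign p) * T y p) = y *\<^sub>R trace D" for y
    by (simp add: T_def trace_def mat_def scaleR_sum_right sign_id)
  finally show ?thesis
    using der by (simp add: has_vector_derivative_def)
qed

lemma mexp_scaleR_add: "mexp ((s + t) *\<^sub>R A) = mexp (s *\<^sub>R A) ** mexp (t *\<^sub>R A)"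
  unfolding scaleR_add_left by (rule mexp_add) (simp add: scaleR_matrix_mult)

text \<open>The quotient \<phi> of the two sides along t A is multiplicative in t and has derivative
  0 at 0. Multiplicativity carries the vanishing derivative to every t, so \<phi> is
  constant.\<close>

lemma det_mexp: "det (mexp A) = exp (trace A)"
proof -
  define \<phi> where "\<phi> t = det (mexp (t *\<^sub>R A)) * exp (t *\<^sub>R (- trace A))" for t
  have add: "\<phi> (s + t) = \<phi> s * \<phi> t" for s t
    unfolding \<phi>_def
    by (simp only: mexp_scaleR_add det_mul) (simp only: scaleR_add_left exp_add mult_ac)
  have "((\<lambda>t. mexp (t *\<^sub>R A)) has_vector_derivative A) (at 0)"
    using mexp_has_vector_derivative[of A 0] by simp
  from det_has_vector_derivative_at_mat_1[OF this]
  have "((\<lambda>t. det (mexp (t *\<^sub>R A))) has_vector_derivative trace A) (at 0)"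
    by simp
  from has_vector_derivative_mult[OF this exp_scaleR_has_vector_derivative_0[of "- trace A"]]
  have "(\<phi> has_vector_derivative 0) (at 0)"
    by (simp add: \<phi>_def[abs_def] det_I)
  then have 0: "(\<phi> has_derivative (\<lambda>_. 0)) (at 0)"
    by (simp add: has_vector_derivative_def)
  have "(\<phi> has_derivative (\<lambda>_. 0)) (at t)" for t
  proof -
    have "((\<lambda>s. s - t) has_derivative (\<lambda>s. s)) (at t)"
      by (auto intro!: derivative_eq_intros)
    from has_derivative_compose[OF this, of \<phi> "\<lambda>_. 0"] 0
    have "((\<lambda>s. \<phi> (s - t)) has_derivative (\<lambda>_. 0)) (at t)"
      by simp
    from has_derivative_mult_right[OF this, of "\<phi> t"]
    have "((\<lambda>s. \<phi> t * \<phi> (s - t)) has_derivative (\<lambda>_. 0)) (at t)"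
      by simp
    moreover have "\<phi> t * \<phi> (s - t) = \<phi> s" for s
      using add[of t "s - t"] by simp
    ultimately show ?thesis by simp
  qed
  then have "\<phi> 1 = \<phi> 0"
    by (intro has_derivative_zero_unique[of UNIV \<phi> 1 0]) auto
  then have "det (mexp A) * exp (- trace A) = 1"
    by (simp add: \<phi>_def det_I)
  then show ?thesis
    by (simp add: exp_minus field_simps)
qed

section \<open>SU(N) as a compact group\<close>

lemma SU_mult: "A \<in> SU \<Longrightarrow> B \<in> SU \<Longrightarrow> A ** B \<in> SU"
proof -
  assume "A \<in> SU" "B \<in> SU"
  then have "dagger A ** A = mat 1" "A ** dagger A = mat 1" "dagger B ** B = mat 1" "B ** dagger B = mat 1"
    "det A = 1" "det B = 1"
    by (auto simp: SU_def unitary_def)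
  then show ?thesis
    by (simp add: SU_def unitary_def dagger_mult det_mul) (metis matrix_mul_assoc matrix_mul_rid)
qed

lemma SU_dagger: "A \<in> SU \<Longrightarrow> dagger A \<in> SU"
proof -
  assume A: "A \<in> SU"
  then have "det (dagger A) * det A = 1"
    unfolding det_mul[symmetric] by (simp add: SU_def unitary_def det_I)
  with A show ?thesis by (simp add: SU_def unitary_def)
qed

lemma norm_unitary:
  fixes A :: "'n::finite cmat"
  assumes "unitary A"
  shows "norm A = sqrt (real CARD('n))"
proof -
  have "complex_of_real ((norm A)\<^sup>2) = of_real (real CARD('n))"
    using assms trace_dagger_mult[of A] by (simp add: unitary_def trace_I)
  then have "(norm A)\<^sup>2 = real CARD('n)"
    by (simp only: of_real_eq_iff)
  then show ?thesis by (metis norm_ge_zero real_sqrt_unique)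
qed

lemma compact_SU: "compact (SU :: 'n::finite cmat set)"
  unfolding compact_eq_bounded_closed
proof
  show "bounded (SU :: 'n cmat set)"
    unfolding bounded_iff by (auto simp: SU_def norm_unitary)
  have d: "continuous_on UNIV (dagger :: 'n cmat \<Rightarrow> 'n cmat)"
    by (intro linear_continuous_on bounded_linear_dagger)
  have "continuous_on UNIV (det :: 'n cmat \<Rightarrow> complex)"
    unfolding det_def[abs_def] by (intro continuous_intros)
  moreover have "continuous_on UNIV (\<lambda>A :: 'n cmat. dagger A ** A)" "continuous_on UNIV (\<lambda>A :: 'n cmat. A ** dagger A)"
    by (intro bounded_bilinear.continuous_on[OF bounded_bilinear_cmat_mult] d continuous_on_id)+
  ultimately show "closed (SU :: 'n cmat set)"
    unfolding SU_def unitary_def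
    by (intro closed_Collect_conj closed_Collect_eq continuous_on_const) auto
qed

lemma mexp_minus: "mexp A ** mexp (- A) = mat 1"
proof -
  have "A ** (- A) = (- A) ** A"
    by (simp add: vec_eq_iff matrix_matrix_mult_def)
  from mexp_add[OF this] show ?thesis by simp
qed

lemma mexp_su: "A \<in> su \<Longrightarrow> mexp A \<in> SU"
  using mexp_minus[of A] mexp_minus[of "- A"]
  by (auto simp: su_def SU_def unitary_def dagger_mexp det_mexp)

section \<open>Generating \<^const>\<open>SU\<close> by exponentials\<close>

lemma skew_hermitian_decompose:
  fixes A :: "'n::finite cmat"
  assumes "dagger A = - A"
  obtains B y where "B \<in> su" "A = B + (\<i> * of_real y) *\<^sub>C mat 1"
proof -
  \<comment> \<open>The trace of a skew-Hermitian matrix is purely imaginary; this \<open>y\<close>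
    gives the scalar part the same trace as \<open>A\<close>.\<close>
  define y where "y = Im (trace A) / real CARD('n)"
  have "trace (dagger A) = cnj (trace A)"
    by (simp add: trace_def)
  with assms have "cnj (trace A) = - trace A"
    using trace_linear(2)[of "-1" A] by simp
  then have "Re (trace A) = 0"
    by (simp add: complex_eq_iff)
  then have tr: "trace A = of_nat CARD('n) * (\<i> * of_real y)"
    by (simp add: complex_eq_iff y_def)
  show thesis
  proof
    show "A - (\<i> * of_real y) *\<^sub>C mat 1 \<in> su"
      using assms tr by (simp add: su_def trace_sub trace_I) (simp add: vec_eq_iff)
  qed simp
qed

lemma mexp_scalar: "mexp (z *\<^sub>C mat 1) = exp z *\<^sub>C mat 1"
  by (simp add: mexp_projection vec_eq_iff algebra_simps)

lemma mexp_add_scalar: "mexp (A + z *\<^sub>C mat 1) = exp z *\<^sub>C mexp A"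
proof -
  have "mexp (A + z *\<^sub>C mat 1) = mexp A ** mexp (z *\<^sub>C mat 1)"
    by (rule mexp_add) (simp add: cscale_mult)
  then show ?thesis by (simp add: mexp_scalar cscale_mult)
qed

text \<open>With \<open>c = exp (i \<theta>)\<close>, the witness is
  \<open>i \<theta> (1 - N E)\<close>, where \<open>E\<close> is a coordinate projection of rank one.\<close>

lemma scalar_SU_mexp:
  assumes "c ^ CARD('n) = 1"
  obtains A :: "'n::finite cmat" where "A \<in> su" "mexp A = c *\<^sub>C mat 1"
proof -
  have "norm c ^ CARD('n) = 1"
    using assms by (metis norm_one norm_power)
  then have "norm c = 1"
    using power_eq_iff_eq_base[of "CARD('n)" "norm c" 1] by simp
  then obtain \<theta> where c: "c = exp (\<i> * of_real \<theta>)"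
    by (metis complex_unimodular_polar cis_conv_exp cis.code Complex_eq cis.ctr)
  define k :: 'n where "k = undefined"
  define E :: "'n cmat" where "E = (\<chi> i j. if i = k \<and> j = k then 1 else 0)"
  define z where "z = - (of_nat CARD('n) * (\<i> * of_real \<theta>))"
  have EE: "E ** E = E"
  proof -
    have "E $ i $ l * E $ l $ j = (if l = k then E $ i $ j else 0)" for i l j
      by (simp add: E_def)
    then show ?thesis
      by (simp add: matrix_matrix_mult_def vec_eq_iff)
  qed
  have "trace E = 1"
    by (simp add: E_def trace_def)
  then have "z *\<^sub>C E + (\<i> * of_real \<theta>) *\<^sub>C mat 1 \<in> su"
    by (simp add: su_def trace_add trace_I z_def) (auto simp: vec_eq_iff E_def mat_def)
  \<comment> \<open>Since exp z = c^(-N) = 1, the multiple of \<open>E\<close> restores trace 0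
    without affecting the exponential.\<close>
  moreover have "exp z = 1"
    using assms by (simp add: z_def c exp_minus flip: exp_of_nat_mult)
  then have "mexp (z *\<^sub>C E + (\<i> * of_real \<theta>) *\<^sub>C mat 1) = c *\<^sub>C mat 1"
    by (simp add: mexp_add_scalar mexp_projection EE c) (simp add: vec_eq_iff)
  ultimately show thesis using that by blast
qed

text \<open>Unit scalars are adjoined to \<open>K\<close> because the exponents that arise, such as
  i \<pi> P, are skew-Hermitian but in general not traceless; \<open>W\<close> contains their
  exponentials.\<close>

lemma SU_subset_if_mexp_su:
  fixes K :: "'n::finite cmat set"
  assumes "compact K" "mat 1 \<in> K"
    and mult: "\<And>A B. A \<in> K \<Longrightarrow> B \<in> K \<Longrightarrow> A ** B \<in> K"
    and K_SU: "K \<subseteq> SU" and dag: "\<And>A. A \<in> K \<Longrightarrow> dagger A \<in> K"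
    and mexp: "\<And>A. A \<in> su \<Longrightarrow> mexp A \<in> K"
  shows "SU \<subseteq> K"
proof
  fix U :: "'n cmat"
  assume U: "U \<in> SU"
  define W where "W = (\<lambda>(c, k). c *\<^sub>C k) ` (sphere 0 1 \<times> K)"
  have WI: "c *\<^sub>C k \<in> W" if "norm c = 1" "k \<in> K" for c k
    using that by (force simp: W_def)
  have WE: "\<exists>c k. norm c = 1 \<and> k \<in> K \<and> w = c *\<^sub>C k" if "w \<in> W" for w
    using that by (auto simp: W_def)
  have W_mult: "v ** w \<in> W" if vw: "v \<in> W" "w \<in> W" for v w
    using WE[OF vw(1)] WE[OF vw(2)] mult WI
    by (auto simp: cscale_mult cscale_simps norm_mult)
  have W_unit: "dagger w ** w = mat 1" "w ** dagger w = mat 1" if w: "w \<in> W" for w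
    using WE[OF w] K_SU
    by (auto simp: cscale_mult cscale_simps SU_def unitary_def complex_norm_square[symmetric] mult.commute[of "cnj _"])
  have W_dagger: "dagger w \<in> W" if w: "w \<in> W" for w
    using WE[OF w] dag WI by auto
  have W_mexp: "mexp A \<in> W" if A: "dagger A = - A" for A
  proof -
    obtain B y where "B \<in> su" "A = B + (\<i> * of_real y) *\<^sub>C mat 1"
      using skew_hermitian_decompose[OF A] .
    then show ?thesis
      using mexp WI by (simp add: mexp_add_scalar)
  qed
  have UU: "dagger U ** U = mat 1" "U ** dagger U = mat 1" "det U = 1"
    using U by (auto simp: SU_def unitary_def)
  have bl: "bounded_linear (\<lambda>M. Re (trace (B ** M)))" for B :: "'n cmat"
    by (intro bounded_linear_compose[OF bounded_linear_Re] bounded_linear_compose[OF bounded_linear_trace]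
        bounded_bilinear.bounded_linear_right[OF bounded_bilinear_cmat_mult])
  have "compact W"
    unfolding W_def case_prod_unfold
    by (intro compact_continuous_image compact_Times compact_sphere assms(1)
        bounded_bilinear.continuous_on[OF bounded_bilinear_cscale] continuous_intros)
  moreover have "W \<noteq> {}"
    using WI[of 1] assms(2) by auto
  moreover have "continuous_on W (\<lambda>w. Re (trace (U ** w)))"
    by (rule linear_continuous_on[OF bl])
  ultimately obtain w where w: "w \<in> W" and max: "\<And>v. v \<in> W \<Longrightarrow> Re (trace (U ** v)) \<le> Re (trace (U ** w))"
    using continuous_attains_sup[of W "\<lambda>w. Re (trace (U ** w))"] by metis
  define V where "V = U ** w"
  have VV: "dagger V ** V = mat 1" "V ** dagger V = mat 1"
  proof -
    have "dagger V ** V = dagger w ** (dagger U ** U) ** w" "V ** dagger V = U ** (w ** dagger w) ** dagger U"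
      by (simp_all add: V_def dagger_mult matrix_mul_assoc)
    then show "dagger V ** V = mat 1" "V ** dagger V = mat 1"
      by (simp_all add: UU W_unit[OF w])
  qed
  \<comment> \<open>First-order condition along the curve \<open>w ** mexp (t *\<^sub>R A)\<close>,
    which stays in \<open>W\<close> and passes through the maximizer at t = 0.\<close>
  have crit: "Re (trace (V ** A)) = 0" if A: "dagger A = - A" for A
  proof -
    define f where "f t = Re (trace (V ** mexp (t *\<^sub>R A)))" for t
    have "((\<lambda>t. mexp (t *\<^sub>R A)) has_vector_derivative A) (at 0)"
      using mexp_has_vector_derivative[of A 0] by simp
    from bounded_linear.has_vector_derivative[OF bl this]
    have "(f has_real_derivative Re (trace (V ** A))) (at 0)"
      by (simp add: f_def[abs_def] has_real_derivative_iff_has_vector_derivative)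
    moreover have "f t \<le> f 0" for t
      using max[OF W_mult[OF w W_mexp[of "t *\<^sub>R A"]]] A
      by (simp add: f_def V_def matrix_mul_assoc)
    ultimately show ?thesis
      using DERIV_local_max[of f _ 0 1] by auto
  qed
  have V_herm: "dagger V = V"
  proof -
    \<comment> \<open>The skew-Hermitian test direction for which the first-order condition computes
      the Frobenius norm of \<open>?A\<close> itself, as \<open>V\<close> is unitary.\<close>
    let ?A = "dagger V - V"
    have trace_dag: "trace (dagger V ** dagger V) = cnj (trace (V ** V))"
      by (simp add: trace_def flip: dagger_mult)
    have "dagger ?A ** ?A = (V ** dagger V - V ** V) - (dagger V ** dagger V - dagger V ** V)"
      by (simp add: matrix_mult_diff_distrib algebra_simps)
    also have "Re (trace \<dots>) = 2 * Re (trace (V ** ?A))"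
      by (simp only: matrix_mult_diff_distrib trace_sub trace_dag VV) simp
    also have "\<dots> = 0" using crit[of ?A] by simp
    finally have "(norm ?A)\<^sup>2 = 0"
      unfolding trace_dagger_mult by (metis Re_complex_of_real)
    then show ?thesis by simp
  qed
  have V_W: "V \<in> W"
  proof -
    \<comment> \<open>\<open>V\<close> is a Hermitian involution, and \<open>P\<close> projects onto
      its eigenspace for -1. As exp(i \<pi>) - 1 = -2, the exponential of i \<pi> P is 1 - 2P =
      V.\<close>
    define P where "P = (1 / 2) *\<^sub>R (mat 1 - V)"
    have "V ** V = mat 1" using VV V_herm by simp
    then have PP: "P ** P = P"
      by (simp add: P_def scaleR_matrix_mult matrix_mult_diff_distrib) (simp add: vec_eq_iff complex_eq_iff field_simps)
    have "mexp ((\<i> * of_real pi) *\<^sub>C P) = mat 1 + (- 2) *\<^sub>C P"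
      by (simp add: mexp_projection[OF PP])
    also have "\<dots> = V"
      by (simp add: P_def vec_eq_iff complex_eq_iff field_simps)
    finally have "mexp ((\<i> * of_real pi) *\<^sub>C P) = V" .
    moreover have "dagger ((\<i> * of_real pi) *\<^sub>C P) = - ((\<i> * of_real pi) *\<^sub>C P)"
      by (simp add: P_def V_herm) (simp add: vec_eq_iff)
    ultimately show ?thesis
      using W_mexp by metis
  qed
  have "U = V ** dagger w"
    by (simp add: V_def W_unit[OF w] flip: matrix_mul_assoc)
  then have "U \<in> W"
    using W_mult[OF V_W W_dagger[OF w]] by simp
  then obtain c k where ck: "norm c = 1" "k \<in> K" "U = c *\<^sub>C k"
    using WE by blast
  \<comment> \<open>Comparing determinants makes \<open>c\<close> an N-th root of unity, so the
    scalar matrix \<open>c *\<^sub>C mat 1\<close> is an exponential of an element of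
    \<open>su\<close> and lies in \<open>K\<close>.\<close>
  have "det k = 1" using ck K_SU by (auto simp: SU_def)
  then have "c ^ CARD('n) = 1"
    using UU(3) by (simp add: ck det_cscale)
  then obtain A :: "'n cmat" where "A \<in> su" "mexp A = c *\<^sub>C mat 1"
    by (rule scalar_SU_mexp)
  then show "U \<in> K"
    using mult[OF mexp[of A] ck(2)] by (simp add: ck cscale_mult)
qed

section \<open>The closed subgroup generated by the control cycles\<close>

lemma sqmat_of_in_image [simp]: "sqmat_of A \<in> sqmat_of ` K \<longleftrightarrow> A \<in> K"
  by (auto simp: sqmat_of_inject)

lemma one_param_sqmat_of:
  "sqmat_of A \<in> one_param (sqmat_of ` K) \<longleftrightarrow> (\<forall>t. mexp (t *\<^sub>R A) \<in> K)"
proof -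
  have "exp (t *\<^sub>R sqmat_of A) = sqmat_of (mexp (t *\<^sub>R A))" for t
    by (simp add: mexp_eq_exp cmat_of_inverse scaleR_sqmat.abs_eq)
  then show ?thesis by (simp add: one_param_def)
qed

lemma compact_sqmat_of_image: "compact K \<Longrightarrow> compact (sqmat_of ` K)"
  by (intro compact_continuous_image linear_continuous_on bounded_linear_sqmat_of)

lemma subspace_su: "subspace su"
  by (rule subspaceI) (auto simp: su_def trace_add, simp add: trace_def)

lemma mcomm_su: "A \<in> su \<Longrightarrow> B \<in> su \<Longrightarrow> mcomm A B \<in> su"
  using trace_mul_sym[of A B]
  by (simp add: su_def mcomm_def dagger_mult trace_sub) (simp add: vec_eq_iff matrix_matrix_mult_def)

context
  fixes K :: "'n::finite cmat set"
  assumes K: "compact K" "mat 1 \<in> K" "\<And>A B. A \<in> K \<Longrightarrow> B \<in> K \<Longrightarrow> A ** B \<in> K"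
begin

lemma sqmat_image_monoid:
  "closed (sqmat_of ` K)" "1 \<in> sqmat_of ` K"
  "x \<in> sqmat_of ` K \<Longrightarrow> y \<in> sqmat_of ` K \<Longrightarrow> x * y \<in> sqmat_of ` K"
  using K compact_imp_closed[OF compact_sqmat_of_image[OF K(1)]]
  by (auto simp: one_sqmat_def times_sqmat.abs_eq)

text \<open>The properties of \<open>one_param\<close> pull back along the linear map
  \<open>sqmat_of\<close>, which turns \<open>mcomm\<close> into the commutator of the
  algebra.\<close>

lemma lie_subalgebra_one_param: "lie_subalgebra_su {A \<in> su. \<forall>t. mexp (t *\<^sub>R A) \<in> K}"
proof -
  let ?P = "one_param (sqmat_of ` K)"
  have eq: "{A \<in> su. \<forall>t. mexp (t *\<^sub>R A) \<in> K} = su \<inter> sqmat_of -` ?P"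
    by (auto simp: one_param_sqmat_of)
  have "subspace (sqmat_of -` ?P)"
    by (intro linear_subspace_vimage bounded_linear.linear bounded_linear_sqmat_of
        subspace_one_param sqmat_image_monoid)
  moreover have "sqmat_of (mcomm A B) \<in> ?P" if "sqmat_of A \<in> ?P" "sqmat_of B \<in> ?P" for A B
    using one_param_commutator[OF sqmat_image_monoid that]
    by (simp add: mcomm_def times_sqmat.abs_eq minus_sqmat.abs_eq)
  ultimately show ?thesis
    unfolding eq lie_subalgebra_su_def
    by (auto intro: subspace_inter subspace_su mcomm_su)
qed

text \<open>In SU the adjoint is the inverse, so this is the closure under inverses of a compact
  submonoid of the bounded semigroup SU.\<close>

lemma submonoid_SU_dagger:
  assumes "K \<subseteq> SU" "A \<in> K"
  shows "dagger A \<in> K"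
proof -
  have "sqmat_of (dagger A) \<in> sqmat_of ` K"
  proof (rule compact_subsemigroup_inverse)
    show "bounded (sqmat_of ` SU)"
      by (intro compact_imp_bounded compact_sqmat_of_image compact_SU)
    show "compact (sqmat_of ` K)"
      by (rule compact_sqmat_of_image[OF K(1)])
    show "sqmat_of A \<in> sqmat_of ` K" "sqmat_of (dagger A) \<in> sqmat_of ` SU"
      using assms SU_dagger by auto
    show "sqmat_of (dagger A) * sqmat_of A = 1"
      using assms by (auto simp: times_sqmat.abs_eq one_sqmat_def SU_def unitary_def)
  qed (use sqmat_image_monoid in \<open>auto simp: times_sqmat.abs_eq SU_mult\<close>)
  then show ?thesis by simp
qed

end

section \<open>The reachable semigroup and its closure\<close>

lemma closure_matrix_mult:
  fixes R :: "'n::finite cmat set"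
  assumes "\<And>A B. A \<in> R \<Longrightarrow> B \<in> R \<Longrightarrow> A ** B \<in> R" "A \<in> closure R" "B \<in> closure R"
  shows "A ** B \<in> closure R"
proof -
  obtain a b where "\<And>n. a n \<in> R" "a \<longlonglongrightarrow> A" "\<And>n. b n \<in> R" "b \<longlonglongrightarrow> B"
    using assms(2,3) unfolding closure_sequential by blast
  then show ?thesis
    unfolding closure_sequential
    using bounded_bilinear.tendsto[OF bounded_bilinear_cmat_mult] assms(1)
    by (intro exI[of _ "\<lambda>n. a n ** b n"]) auto
qed

lemma foldr_matrix_mult_append:
  fixes f :: "'a \<Rightarrow> 'n::finite cmat"
  shows "foldr (**) (map f (as @ bs)) (mat 1) = foldr (**) (map f as) (mat 1) ** foldr (**) (map f bs) (mat 1)"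
  by (induction as) (simp_all add: matrix_mul_assoc)

lemma reachable_mult:
  assumes "A \<in> reachable H J X \<Lambda>" "B \<in> reachable H J X \<Lambda>"
  shows "A ** B \<in> reachable H J X \<Lambda>"
proof -
  obtain as bs where
    "as \<noteq> []" "\<forall>(j, l, t)\<in>set as. j \<in> J \<and> l \<in> \<Lambda> j \<and> 0 \<le> t" "A = foldr (**) (map (cycle_evolution H X) as) (mat 1)"
    "bs \<noteq> []" "\<forall>(j, l, t)\<in>set bs. j \<in> J \<and> l \<in> \<Lambda> j \<and> 0 \<le> t" "B = foldr (**) (map (cycle_evolution H X) bs) (mat 1)"
    using assms unfolding reachable_def by blast
  then show ?thesis
    unfolding reachable_def by (auto simp: foldr_matrix_mult_append simp del: map_append intro!: exI[of _ "as @ bs"])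
qed

lemma cycle_evolution_reachable:
  assumes "j \<in> J" "l \<in> \<Lambda> j" "0 \<le> t"
  shows "mexp ((- \<i> * of_real t) *\<^sub>C (H + l *\<^sub>R X j)) \<in> reachable H J X \<Lambda>"
  unfolding reachable_def
  using assms by (auto simp: cycle_evolution_def intro!: exI[of _ "[(j, l, t)]"])

lemma hermitian_imp_su:
  assumes "hermitian A" "trace A = 0"
  shows "(\<i> * of_real t) *\<^sub>C A \<in> su"
  using assms by (simp add: su_def hermitian_def) (simp add: vec_eq_iff)

theorem proposition1:
  fixes H :: "complex ^ 'n::finite ^ 'n"
    and J :: "'j set"
    and X :: "'j \<Rightarrow> complex ^ 'n ^ 'n"
    and \<Lambda> :: "'j \<Rightarrow> real set"
  assumes "2 \<le> CARD('n)"
    and "hermitian H" and "trace H = 0"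
    and "J \<noteq> {}"
    and "\<And>j. j \<in> J \<Longrightarrow> hermitian (X j)"
    and "\<And>j. j \<in> J \<Longrightarrow> trace (X j) = 0"
    and "\<And>j. j \<in> J \<Longrightarrow> 0 \<in> \<Lambda> j"
    and "\<And>j R. j \<in> J \<Longrightarrow> \<exists>l\<in>\<Lambda> j. R < \<bar>l\<bar>"
    and "lie_generates_su (insert (\<i> *\<^sub>C H) ((\<lambda>j. \<i> *\<^sub>C X j) ` J))"
  shows "reachable H J X \<Lambda> \<subseteq> SU \<and>
    (top_of_set SU) closure_of (reachable H J X \<Lambda>) = SU"
proof -
  let ?R = "reachable H J X \<Lambda>"
  have su: "(\<i> * of_real t) *\<^sub>C (H + l *\<^sub>R X j) \<in> su" if "j \<in> J" for t l j
    using assms(2,3) assms(5,6)[OF that]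
    by (intro hermitian_imp_su) (simp_all add: hermitian_def trace_add)
  have cycle_SU: "cycle_evolution H X c \<in> SU" if "fst c \<in> J" for c
    using mexp_su[OF su[OF that, of "- snd (snd c)"]]
    by (simp add: cycle_evolution_def case_prod_unfold)
  have one_SU: "mat 1 \<in> (SU :: 'n cmat set)"
    by (simp add: SU_def unitary_def det_I)
  have "foldr (**) (map (cycle_evolution H X) cs) (mat 1) \<in> SU" if "\<forall>c\<in>set cs. fst c \<in> J" for cs
    using that by (induction cs) (auto intro: SU_mult cycle_SU one_SU)
  then have R_SU: "?R \<subseteq> SU"
    unfolding reachable_def by fastforce
  define K where "K = closure ?R"
  have K_SU: "K \<subseteq> SU"
    unfolding K_def by (intro closure_minimal R_SU compact_imp_closed compact_SU)
  have K1: "compact K"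
    unfolding K_def using bounded_subset[OF compact_imp_bounded[OF compact_SU] R_SU] by simp
  obtain j0 where j0: "j0 \<in> J" using assms(4) by blast
  \<comment> \<open>Products are nonempty, so the identity is realized as a single cycle of duration
    0.\<close>
  have "mexp ((- \<i> * of_real 0) *\<^sub>C (H + 0 *\<^sub>R X j0)) \<in> ?R"
    using j0 assms(7) by (intro cycle_evolution_reachable) auto
  moreover have "(- \<i> * of_real 0) *\<^sub>C (H + 0 *\<^sub>R X j0) = 0"
    by (simp add: vec_eq_iff)
  ultimately have K2: "mat 1 \<in> K"
    unfolding K_def using closure_subset by auto
  have K3: "A ** B \<in> K" if "A \<in> K" "B \<in> K" for A B
    using that unfolding K_def by (intro closure_matrix_mult reachable_mult)
  note dag = submonoid_SU_dagger[OF K1 K2 K3 K_SU]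
  define L where "L = {A \<in> su. \<forall>t. mexp (t *\<^sub>R A) \<in> K}"
  have L: "lie_subalgebra_su L"
    unfolding L_def by (rule lie_subalgebra_one_param[OF K1 K2 K3])
  then have "subspace L" by (simp add: lie_subalgebra_su_def)
  have HX: "\<i> *\<^sub>C (H + l *\<^sub>R X j) \<in> L" if j: "j \<in> J" "l \<in> \<Lambda> j" for j l
  proof -
    let ?A = "\<i> *\<^sub>C (H + l *\<^sub>R X j)"
    have A: "?A \<in> su" using su[OF j(1), of 1] by simp
    \<comment> \<open>Because of the sign in the evolution, parameter t corresponds to duration -t:
      nonpositive t are reached directly, positive t through the adjoint.\<close>
    have eq: "t *\<^sub>R ?A = (- \<i> * of_real (- t)) *\<^sub>C (H + l *\<^sub>R X j)" for t
      by (simp add: vec_eq_iff) (simp add: scaleR_conv_of_real algebra_simps)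
    have neg: "mexp (t *\<^sub>R ?A) \<in> K" if "t \<le> 0" for t
      unfolding eq K_def using that j
      by (intro subsetD[OF closure_subset] cycle_evolution_reachable) auto
    have "mexp (t *\<^sub>R ?A) \<in> K" for t
    proof (cases "t \<le> 0")
      case False
      then have "- t \<le> 0" by simp
      then have "dagger (mexp ((- t) *\<^sub>R ?A)) \<in> K"
        by (intro dag neg)
      then show ?thesis
        using A by (simp add: dagger_mexp su_def)
    qed (rule neg)
    with A show ?thesis by (simp add: L_def)
  qed
  have iH: "\<i> *\<^sub>C H \<in> L"
    using HX[OF j0 assms(7)[OF j0]] by simp
  have "\<i> *\<^sub>C X j \<in> L" if j: "j \<in> J" for j
  proof -
    \<comment> \<open>A nonzero admissible coefficient; subtracting iH and dividing by
      \<open>l\<close> isolates the control term.\<close>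
    obtain l where l: "l \<in> \<Lambda> j" "0 < \<bar>l\<bar>" using assms(8)[OF j, of 0] by blast
    have "(1 / l) *\<^sub>R (\<i> *\<^sub>C (H + l *\<^sub>R X j) - \<i> *\<^sub>C H) \<in> L"
      by (intro subspace_mul subspace_diff \<open>subspace L\<close> HX iH j l(1))
    also have "(1 / l) *\<^sub>R (\<i> *\<^sub>C (H + l *\<^sub>R X j) - \<i> *\<^sub>C H) = \<i> *\<^sub>C X j"
      using l(2) by (simp add: vec_eq_iff) (simp add: scaleR_conv_of_real algebra_simps)
    finally show ?thesis .
  qed
  with iH have "lie_subalgebra_su hull (insert (\<i> *\<^sub>C H) ((\<lambda>j. \<i> *\<^sub>C X j) ` J)) \<subseteq> L"
    using L by (intro hull_minimal) auto
  then have "su \<subseteq> L"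
    using assms(9) by (simp add: lie_generates_su_def)
  then have mexp: "mexp A \<in> K" if "A \<in> su" for A
    using that scaleR_one[of A] unfolding L_def by (metis (mono_tags, lifting) mem_Collect_eq subsetD)
  have "SU \<subseteq> K"
    by (intro SU_subset_if_mexp_su K1 K2 K3 K_SU dag mexp)
  \<comment> \<open>The closure relative to SU is the intersection of SU with \<open>K\<close>, the
    closure among all matrices.\<close>
  then have "(top_of_set SU) closure_of ?R = SU"
    using R_SU by (simp add: closure_of_subtopology Int_absorb1 Int_absorb2 K_def)
  with R_SU show ?thesis by blast
qed

end
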